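(* Let $n\ge 2$, $d\ge 1$, $N=n+d$, $V=(\mathbb F_2)^N$. Consider the following algorithm. INPUT: $$\lambda=\begin{bmatrix}\Lambda_1&*\\0&\Lambda_3\end{bmatrix},\qquad \Lambda_1\in\mathrm{GL}((\mathbb F_2)^n),\ \Lambda_3\in\mathrm{GL}((\mathbb F_2)^d),$$ where $*$ denotes any matrix in $(\mathbb F_2)^{n\times d}$. STEPS: I) Consider the canonical basis $\mathbf e_1,\dots,\mathbf e_{n+d}$ and compute $\mathbf e_1\lambda,\dots,\mathbf e_n\lambda$. II) Solve the linear system, in the entries of matrices $B_{\mathbf e_1},\dots,B_{\mathbf e_{n+d}}\in(\mathbb F_2)^{n\times d}$, given by the equations: 1. for all $i=1,\dots,n$: $B_{\mathbf e_i}\Lambda_3=\Lambda_1B_{\mathbf e_i\lambda}=\Lambda_1\left(\sum_{j=1}^n c_{j}B_{\mathbf e_j}\right)$, where $c_{1},\dots,c_{n}$ are the first $n$ components of the vector $\mathbf e_i\lambda$; 2. for all $i=n+1,\dots,n+d$: $B_{\mathbf e_i}=0$; 3. for all $i=1,\dots,n$: $\bar{\mathbf e}_iB_{\mathbf e_i}=0$; 4. for all $i,j=1,\dots,n$: $\bar{\mathbf e}_iB_{\mathbf e_j}=\bar{\mathbf e}_jB_{\mathbf e_i}$, where $\bar{\mathbf e}_i$ is the truncation of $\mathbf e_i$ to the first $n$ coordinates. III) Return the solutions $\{B_{\mathbf e_i}\}_{i=1,\dots,n+d}$. Then the algorithm is correct, with the following OUTPUT: all practical hidden sums $\circ$, with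 $$\kappa_{\mathbf e_i}=\begin{bmatrix}I_n&B_{\mathbf e_i}\\0&I_d\end{bmatrix},\qquad B_{\mathbf e_i}\in(\mathbb F_2)^{n\times d},\quad 1\le i\le n,$$ such that - $T_\circ\subseteq\mathrm{AGL}(V,+)$ and $T_+\subseteq\mathrm{AGL}(V,\circ)$; - $U(T_\circ)$ contains $\mathbf e_{n+1},\dots,\mathbf e_{n+d}$; - $\lambda\in\mathrm{GL}(V,\circ)$. That is, for every solution returned, the group $T_\circ=\langle\tau_{\mathbf e_1},\dots,\tau_{\mathbf e_{n+d}}\rangle$ generated by the maps $\tau_{\mathbf e_i}:\mathbf x\mapsto\mathbf x\begin{bmatrix}I_n&B_{\mathbf e_i}\\0&I_d\end{bmatrix}+\mathbf e_i$ is the translation group of a practical hidden sum with these properties; and conversely, for every practical hidden sum with these properties, the associated matrices $B_{\mathbf e_i}$ satisfy the system.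
   Context: Vectors are row vectors and maps act on the right: $\mathbf x\lambda$ is the image of $\mathbf x$ under $\lambda$. $\mathbf e_1,\dots,\mathbf e_N$ is the canonical basis of $V=(\mathbb F_2)^N$ and $+$ is the usual sum. $\sigma_{\mathbf v}:\mathbf x\mapsto\mathbf x+\mathbf v$ and $T_+=\{\sigma_{\mathbf v}\mid\mathbf v\in V\}$; $\mathrm{GL}(V,+)$ and $\mathrm{AGL}(V,+)$ are the usual linear and affine groups. For an operation $\circ$ making $(V,\circ)$ a vector space over $\mathbb F_2$ (with neutral element $0$), the translation group is $T_\circ=\{\tau_{\mathbf a}\mid\mathbf a\in V\}$, where $\tau_{\mathbf a}:\mathbf x\mapsto\mathbf x\circ\mathbf a$; it is an elementary abelian group acting regularly on $V$. Conversely, any elementary abelian 2-subgroup $T$ of $\mathrm{Sym}(V)$ acting regularly on $V$ is the translation group of the operation $\mathbf x\circ\mathbf a=\mathbf x\tau_{\mathbf a}$, where $\tau_{\mathbf a}$ is the unique element of $T$ sending $0$ to $\mathbf a$. $\mathrm{GL}(V,\circ)$ is the group of permutations $\lambda$ of $V$ with $(\mathbf x\circ\mathbf y)\lambda=\mathbf x\lambda\circ\mathbf y\lambda$ for all $\mathbf x,\mathbf y\in V$, and $\mathrm{AGL}(V,\circ)$ consists of the compositions of an element of $\mathrm{GL}(V,\circ)$ with an element of $T_\circ$. A hidden sum is any vector space structure $(V,\circ)$, different from the usual $(V,+)$, such that $T_+\subseteq\mathrm{AGL}(V,\circ)$. A practical hidden sum is a hidden sum such that $T_\circ$ is also contained in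 $\mathrm{AGL}(V,+)$. If $T_\circ\subseteq\mathrm{AGL}(V,+)$, each $\tau_{\mathbf a}$ is written as $\tau_{\mathbf a}=\kappa_{\mathbf a}\sigma_{\mathbf a}$ with $\kappa_{\mathbf a}\in\mathrm{GL}(V,+)$ (so $\mathbf x\circ\mathbf a=\mathbf x\kappa_{\mathbf a}+\mathbf a$), and $U(T_\circ)=\{\mathbf v\in V\mid\sigma_{\mathbf v}\in T_\circ\}$. For $\mathbf x=(x_1,\dots,x_{n+d})\in V$, $B_{\mathbf x}=\sum_{j=1}^n x_jB_{\mathbf e_j}$, so that $\kappa_{\mathbf x}=\begin{bmatrix}I_n&B_{\mathbf x}\\0&I_d\end{bmatrix}$.
   Formalization: The zero solution (all B_{e_i}=0) always solves the system but gives the usual sum +, which by definition is not a hidden sum; for it the theorem states ∘ = + with all the other listed properties, and it claims a practical hidden sum only for every nonzero solution. *)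

theory Defs
  imports "HOL-Analysis.Analysis" "HOL-Library.Z2" "HOL-Algebra.Bij" "HOL-Algebra.Generated_Groups"
begin

text \<open>
  The field with two elements is \<^typ>\<open>bit\<close>. The space of dimension \<open>N = n + d\<close> is
  \<open>bit ^ ('n + 'd)\<close> with \<open>n = CARD('n)\<close> and \<open>d = CARD('d)\<close>: the indices \<open>Inl i\<close> are the first
  \<open>n\<close> coordinates and the indices \<open>Inr j\<close> are the last \<open>d\<close> ones. Vectors are row vectors, so a
  matrix acts by \<open>x \<mapsto> x v* A\<close>, and an \<open>r \<times> c\<close> matrix has type \<open>bit ^ 'c ^ 'r\<close>.
\<close>

section \<open>Operations, translation groups, affine groups\<close>

text \<open>The second conjunct only asserts that a scalar multiplication exists; over the field
  with two elements it is determined by the operation.\<close>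
definition F2_vector_space :: "('v::zero \<Rightarrow> 'v \<Rightarrow> 'v) \<Rightarrow> bool" where
  "F2_vector_space circ \<longleftrightarrow>
     comm_group \<lparr>carrier = UNIV, mult = circ, one = 0\<rparr> \<and>
     (\<exists>scale :: bit \<Rightarrow> 'v \<Rightarrow> 'v.
        (\<forall>a x y. scale a (circ x y) = circ (scale a x) (scale a y)) \<and>
        (\<forall>a b x. scale (a + b) x = circ (scale a x) (scale b x)) \<and>
        (\<forall>a b x. scale (a * b) x = scale a (scale b x)) \<and>
        (\<forall>x. scale 1 x = x))"

definition translation_group :: "('v \<Rightarrow> 'v \<Rightarrow> 'v) \<Rightarrow> ('v \<Rightarrow> 'v) set" where
  "translation_group circ = {\<lambda>x. circ x a | a. True}"

definition GL_circ :: "('v \<Rightarrow> 'v \<Rightarrow> 'v) \<Rightarrow> ('v \<Rightarrow> 'v) set" where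
  "GL_circ circ = {f. bij f \<and> (\<forall>x y. f (circ x y) = circ (f x) (f y))}"

definition AGL_circ :: "('v \<Rightarrow> 'v \<Rightarrow> 'v) \<Rightarrow> ('v \<Rightarrow> 'v) set" where
  "AGL_circ circ = {t \<circ> f | t f. t \<in> translation_group circ \<and> f \<in> GL_circ circ}"

definition GL_plus :: "(bit ^ 'm \<Rightarrow> bit ^ 'm) set" where
  "GL_plus = {f. bij f \<and> Vector_Spaces.linear (*s) (*s) f}"

definition AGL_plus :: "(bit ^ 'm \<Rightarrow> bit ^ 'm) set" where
  "AGL_plus = {t \<circ> f | t f. t \<in> translation_group (+) \<and> f \<in> GL_plus}"

definition hidden_sum :: "(bit ^ 'm \<Rightarrow> bit ^ 'm \<Rightarrow> bit ^ 'm) \<Rightarrow> bool" where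
  "hidden_sum circ \<longleftrightarrow>
     F2_vector_space circ \<and> circ \<noteq> (+) \<and> translation_group (+) \<subseteq> AGL_circ circ"

definition practical_hidden_sum :: "(bit ^ 'm \<Rightarrow> bit ^ 'm \<Rightarrow> bit ^ 'm) \<Rightarrow> bool" where
  "practical_hidden_sum circ \<longleftrightarrow> hidden_sum circ \<and> translation_group circ \<subseteq> AGL_plus"

text \<open>The map \<open>\<kappa>\<^sub>a\<close> with \<open>\<tau>\<^sub>a = \<kappa>\<^sub>a \<sigma>\<^sub>a\<close>, where composition is read from left to right.\<close>
definition kappa :: "('v::ab_group_add \<Rightarrow> 'v \<Rightarrow> 'v) \<Rightarrow> 'v \<Rightarrow> 'v \<Rightarrow> 'v" where
  "kappa circ a = (\<lambda>x. circ x a - a)"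

definition U_set :: "('v::plus \<Rightarrow> 'v) set \<Rightarrow> 'v set" where
  "U_set T = {v. (\<lambda>x. x + v) \<in> T}"

section \<open>The algorithm\<close>

text \<open>The block matrix with rows \<open>(P, Q)\<close> and \<open>(0, R)\<close>.\<close>
definition block_upper ::
  "bit ^ 'n::finite ^ 'n \<Rightarrow> bit ^ 'd::finite ^ 'n \<Rightarrow> bit ^ 'd ^ 'd \<Rightarrow> bit ^ ('n + 'd) ^ ('n + 'd)" where
  "block_upper P Q R = (\<chi> r c. case r of
      Inl i \<Rightarrow> (case c of Inl j \<Rightarrow> P $ i $ j | Inr j \<Rightarrow> Q $ i $ j)
    | Inr i \<Rightarrow> (case c of Inl j \<Rightarrow> 0 | Inr j \<Rightarrow> R $ i $ j))"

definition truncate_vec :: "bit ^ ('n::finite + 'd::finite) \<Rightarrow> bit ^ 'n" where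
  "truncate_vec x = (\<chi> i. x $ Inl i)"

text \<open>The families \<open>B\<close> solving the linear system; \<open>B k\<close> is the matrix attached to the basis
  vector \<open>axis k 1\<close>. In the first equation the scalar multiple \<open>c\<^sub>j B\<^sub>j\<close> is taken entrywise.\<close>
definition system_solutions ::
  "bit ^ ('n::finite + 'd::finite) ^ ('n + 'd) \<Rightarrow> bit ^ 'n ^ 'n \<Rightarrow> bit ^ 'd ^ 'd \<Rightarrow> ('n + 'd \<Rightarrow> bit ^ 'd ^ 'n) set"
  where
  "system_solutions lam L1 L3 = {B.
     (\<forall>i::'n. B (Inl i) ** L3 =
        L1 ** (\<Sum>j\<in>(UNIV::'n set).
                 map_matrix ((*) ((axis (Inl i) 1 v* lam) $ Inl j)) (B (Inl j)))) \<and>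
     (\<forall>i::'d. B (Inr i) = 0) \<and>
     (\<forall>i::'n. truncate_vec (axis (Inl i) 1 :: bit ^ ('n + 'd)) v* B (Inl i) = 0) \<and>
     (\<forall>i j::'n. truncate_vec (axis (Inl i) 1 :: bit ^ ('n + 'd)) v* B (Inl j) =
                truncate_vec (axis (Inl j) 1 :: bit ^ ('n + 'd)) v* B (Inl i))}"

definition kappa_matrix :: "bit ^ 'd::finite ^ 'n::finite \<Rightarrow> bit ^ ('n + 'd) ^ ('n + 'd)" where
  "kappa_matrix C = block_upper (mat 1) C (mat 1)"

text \<open>The subgroup of the symmetric group generated by the maps
  \<open>x \<mapsto> x \<kappa>\<^sub>k + e\<^sub>k\<close> for all basis vectors \<open>e\<^sub>k\<close>.\<close>
definition generated_translations ::
  "('n::finite + 'd::finite \<Rightarrow> bit ^ 'd ^ 'n) \<Rightarrow> (bit ^ ('n + 'd) \<Rightarrow> bit ^ ('n + 'd)) set" where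
  "generated_translations B =
     generate (BijGroup UNIV) (range (\<lambda>k x. x v* kappa_matrix (B k) + axis k 1))"

end

theory Submission
  imports Defs
begin

text \<open>
  A family \<open>B\<close> is the same thing as the bilinear map \<open>\<beta>(x, y) = x\<^sub>1 B\<^sub>y\<close>, where \<open>x\<^sub>1\<close> is the truncation
  of \<open>x\<close> to the first \<open>n\<close> coordinates, and it defines the operation \<open>x + y + (0, \<beta>(x, y))\<close>. Equations
  3 and 4 say that \<open>\<beta>\<close> is alternating, which makes the operation an elementary abelian group law, and
  equation 1 says that \<open>\<lambda>\<close> is an isometry of \<open>\<beta>\<close> up to \<open>\<Lambda>\<^sub>3\<close>, i.e. an automorphism of this group.
  Conversely, in a practical hidden sum, the condition on \<open>U\<close> gives equation 2 for the matrices of the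
  \<open>\<kappa>\<close> maps of the basis, and exponent 2 and commutativity give equations 3 and 4. The translations of
  the operation defined by these matrices are generated by those of the basis vectors, hence are
  translations of the given operation, and two regular groups one of which contains the other are
  equal.
\<close>

section \<open>Vectors over the field with two elements\<close>

lemma bit_vec_add_self [simp]: "x + x = (0 :: bit ^ 'm)"
proof -
  have "a + a = 0" for a :: bit
    by (cases a) simp_all
  then show ?thesis
    by (simp only: vec_eq_iff vector_add_component zero_index) simp
qed

lemma bit_vec_add_self_left [simp]: "x + (x + y) = (y :: bit ^ 'm)"
  by (simp flip: add.assoc)

lemma bit_vec_diff [simp]: "x - y = x + (y :: bit ^ 'm)"
  by (simp add: diff_eq_eq add.assoc)

text \<open>Over the field with two elements every vector is a sum of distinct basis vectors, so
  additive closure suffices. This rule extends identities between additive maps from the basis to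
  the whole space.\<close>

lemma bit_vec_induct [case_names zero axis add]:
  fixes x :: "bit ^ 'm::finite"
  assumes "P 0" and "\<And>k. P (axis k 1)" and "\<And>x y. P x \<Longrightarrow> P y \<Longrightarrow> P (x + y)"
  shows "P x"
proof -
  have "P (\<Sum>k\<in>S. x $ k *s axis k 1)" if "finite S" for S
    using that
  proof (induction S rule: finite_induct)
    case empty
    then show ?case using assms(1) by simp
  next
    case (insert k S)
    have "P (x $ k *s axis k 1)"
      using assms(1,2) by (cases "x $ k") simp_all
    then show ?case
      using insert assms(3) by simp
  qed
  from this[of UNIV] show ?thesis
    by (simp add: basis_expansion)
qed

lemma axis_vector_matrix_mult: "axis k 1 v* A = (A :: 'a::comm_semiring_1 ^ 'c ^ 'r::finite) $ k"
  by (simp add: vec_eq_iff vector_matrix_mult_def axis_def if_distrib [of "\<lambda>a. a * _"]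
      cong: if_cong)

lemma matrix_mult_add_rdistrib: "(A + B) ** C = A ** C + B ** C"
  for A B :: "'a::semiring_1 ^ 'm::finite ^ 'n"
  by (simp add: vec_eq_iff matrix_matrix_mult_def distrib_right sum.distrib)

lemma linear_vector_matrix_mult: "Vector_Spaces.linear (*s) (*s) (\<lambda>x. x v* A)"
  for A :: "'a::field ^ 'c ^ 'r::finite"
  unfolding transpose_matrix_vector[symmetric] by (rule matrix_vector_mul_linear_gen)

section \<open>Elementary abelian operations\<close>

text \<open>Scalars can only be 0 and 1, so a scalar multiplication exists exactly when 1 + 1 = 0
  holds in the group, that is, when the exponent divides 2. Later arguments use these four laws
  only.\<close>

lemma F2_vector_space_iff:
  fixes circ :: "'v::zero \<Rightarrow> 'v \<Rightarrow> 'v"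
  shows
  "F2_vector_space circ \<longleftrightarrow>
     (\<forall>x y z. circ (circ x y) z = circ x (circ y z)) \<and> (\<forall>x y. circ x y = circ y x) \<and>
     (\<forall>x. circ x 0 = x) \<and> (\<forall>x. circ x x = 0)"
  (is "_ \<longleftrightarrow> ?R")
proof
  assume F: "F2_vector_space circ"
  define G where "G = \<lparr>carrier = (UNIV :: 'v set), mult = circ, one = 0\<rparr>"
  from F have "comm_group G"
    by (simp add: F2_vector_space_def G_def)
  then interpret comm_group G .
  have group_laws: "circ (circ x y) z = circ x (circ y z)" "circ x y = circ y x" "circ x 0 = x" for x y z
    using m_assoc[of x y z] m_comm[of x y] r_one[of x] by (simp_all add: G_def)
  obtain scale :: "bit \<Rightarrow> 'v \<Rightarrow> 'v" where
      scale: "\<And>a b x. scale (a + b) x = circ (scale a x) (scale b x)" "\<And>x. scale 1 x = x"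
    using F unfolding F2_vector_space_def by blast
  have "scale 0 x = 0" for x
  proof -
    \<comment> \<open>Since 0 + 0 = 0, this element is idempotent, and in a group only the neutral
      element is.\<close>
    have "circ (scale 0 x) (scale 0 x) = scale 0 x"
      using scale(1)[of 0 0 x] by simp
    then show ?thesis
      using l_cancel_one[of "scale 0 x" "scale 0 x"] by (simp add: G_def)
  qed
  then have "circ x x = 0" for x
    using scale(1)[of 1 1 x] scale(2) by simp
  with group_laws show ?R
    by metis
next
  assume R: ?R
  have "comm_group \<lparr>carrier = UNIV, mult = circ, one = 0\<rparr>"
    by (rule comm_groupI, simp_all) (use R in metis)+
  moreover have
    "\<exists>scale :: bit \<Rightarrow> 'v \<Rightarrow> 'v.
        (\<forall>a x y. scale a (circ x y) = circ (scale a x) (scale a y)) \<and>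
        (\<forall>a b x. scale (a + b) x = circ (scale a x) (scale b x)) \<and>
        (\<forall>a b x. scale (a * b) x = scale a (scale b x)) \<and>
        (\<forall>x. scale 1 x = x)"
  proof (rule exI[of _ "\<lambda>a x. if a = 0 then 0 else x"], intro conjI allI)
    fix a b :: bit and x
    show "(if a + b = 0 then 0 else x) = circ (if a = 0 then 0 else x) (if b = 0 then 0 else x)"
      using R by (cases a; cases b) (simp_all, metis+)
  qed (use R in auto)
  ultimately show "F2_vector_space circ"
    by (simp add: F2_vector_space_def)
qed

text \<open>Exponent 2 makes each translation its own inverse.\<close>

lemma bij_translation:
  assumes "F2_vector_space circ"
  shows "bij (\<lambda>x. circ x a)"
  by (rule o_bij[where g = "\<lambda>x. circ x a"]) (use assms in \<open>auto simp: F2_vector_space_iff\<close>)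

lemma subgroup_translation_group:
  assumes F: "F2_vector_space circ"
  shows "subgroup (translation_group circ) (BijGroup UNIV)"
proof -
  interpret group "BijGroup (UNIV :: 'a set)"
    by (rule group_BijGroup)
  note laws = F[unfolded F2_vector_space_iff]
  have carrier: "translation_group circ \<subseteq> carrier (BijGroup UNIV)"
    using bij_translation[OF F] by (auto simp: translation_group_def BijGroup_def Bij_def)
  have mult: "f \<otimes>\<^bsub>BijGroup UNIV\<^esub> g = f \<circ> g"
    if "f \<in> translation_group circ" "g \<in> translation_group circ" for f g
    using that carrier by (auto simp: BijGroup_def compose_def fun_eq_iff)
  have one: "\<one>\<^bsub>BijGroup UNIV\<^esub> = (id :: 'a \<Rightarrow> 'a)"
    by (auto simp: BijGroup_def fun_eq_iff)
  show ?thesis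
  proof (rule subgroupI)
    show "inv\<^bsub>BijGroup UNIV\<^esub> f \<in> translation_group circ" if f: "f \<in> translation_group circ" for f
    proof -
      have "f \<circ> f = id"
        using f laws unfolding translation_group_def fun_eq_iff by (smt (verit) comp_apply id_apply mem_Collect_eq)
      then have "inv\<^bsub>BijGroup UNIV\<^esub> f = f"
        using f carrier mult[OF f f] one by (intro inv_equality) auto
      then show ?thesis
        using f by simp
    qed
    show "f \<otimes>\<^bsub>BijGroup UNIV\<^esub> g \<in> translation_group circ"
      if f: "f \<in> translation_group circ" and g: "g \<in> translation_group circ" for f g
    proof -
      obtain a b where ab: "f = (\<lambda>x. circ x a)" "g = (\<lambda>x. circ x b)"
        using f g by (auto simp: translation_group_def)
      then have "f \<circ> g = (\<lambda>x. circ x (circ b a))"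
        using laws by auto
      then show ?thesis
        using mult[OF f g] by (auto simp: translation_group_def)
    qed
  qed (use carrier in \<open>auto simp: translation_group_def\<close>)
qed

text \<open>Regularity: a translation is determined by the image of 0, so a common translation has
  the same parameter in both groups.\<close>

lemma translation_group_subset_imp_eq:
  assumes "F2_vector_space c" and "F2_vector_space c'"
    and sub: "translation_group c \<subseteq> translation_group c'"
  shows "c = c'"
proof (intro ext)
  fix x a
  obtain b where b: "(\<lambda>x. c x a) = (\<lambda>x. c' x b)"
    using sub by (auto simp: translation_group_def)
  then have "c 0 a = c' 0 b"
    by metis
  then have "a = b"
    using assms(1,2) by (metis F2_vector_space_iff)
  then show "c x a = c' x a"
    using b by metis
qed

section \<open>Block coordinates\<close>

definition embed_last :: "bit ^ 'd::finite \<Rightarrow> bit ^ ('n::finite + 'd)" where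
  "embed_last w = (\<chi> c. case c of Inl i \<Rightarrow> 0 | Inr j \<Rightarrow> w $ j)"

lemma vec_sum_eq_iff: "x = y \<longleftrightarrow> (\<forall>i. x $ Inl i = y $ Inl i) \<and> (\<forall>j. x $ Inr j = y $ Inr j)"
  for x y :: "'a ^ ('n::finite + 'd::finite)"
  by (auto simp: vec_eq_iff split_sum_all)

lemma sum_UNIV_Plus: "(\<Sum>k\<in>UNIV. f k) = (\<Sum>i\<in>UNIV. f (Inl i)) + (\<Sum>j\<in>UNIV. f (Inr j))"
  for f :: "'n::finite + 'd::finite \<Rightarrow> 'a::comm_monoid_add"
  by (simp add: UNIV_Plus_UNIV[symmetric] sum.Plus del: UNIV_Plus_UNIV)

lemma embed_last_add: "embed_last (v + w) = embed_last v + embed_last w"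
  by (simp add: vec_sum_eq_iff embed_last_def)

lemma embed_last_0 [simp]: "embed_last 0 = 0"
  by (simp add: vec_sum_eq_iff embed_last_def)

lemma embed_last_eq_iff [simp]: "embed_last v = embed_last w \<longleftrightarrow> v = w"
  by (auto simp: vec_sum_eq_iff embed_last_def vec_eq_iff)

lemma embed_last_eq_0_iff [simp]: "embed_last v = 0 \<longleftrightarrow> v = 0"
  using embed_last_eq_iff[of v 0] by simp

lemma embed_last_axis: "embed_last (axis j 1) = axis (Inr j) 1"
  by (simp add: vec_sum_eq_iff embed_last_def axis_def)

lemma truncate_vec_add: "truncate_vec (x + y) = truncate_vec x + truncate_vec y"
  by (simp add: vec_eq_iff truncate_vec_def)

lemma truncate_vec_0 [simp]: "truncate_vec 0 = 0"
  by (simp add: vec_eq_iff truncate_vec_def)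

lemma truncate_vec_embed_last [simp]: "truncate_vec (embed_last w) = 0"
  by (simp add: vec_eq_iff truncate_vec_def embed_last_def)

lemma truncate_vec_axis_Inl: "truncate_vec (axis (Inl i) 1) = axis i 1"
  by (simp add: vec_eq_iff truncate_vec_def axis_def)

lemma truncate_vec_eq_0_iff: "truncate_vec x = 0 \<longleftrightarrow> (\<exists>w. x = embed_last w)"
proof
  assume "truncate_vec x = 0"
  then have "x = embed_last (\<chi> j. x $ Inr j)"
    by (simp add: vec_sum_eq_iff) (simp add: vec_eq_iff truncate_vec_def embed_last_def)
  then show "\<exists>w. x = embed_last w" ..
qed auto

lemma truncate_vec_mult_block_upper:
  "truncate_vec (x v* block_upper P Q R) = truncate_vec x v* P"
  by (simp add: vec_eq_iff truncate_vec_def vector_matrix_mult_def block_upper_def sum_UNIV_Plus)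

lemma embed_last_mult_block_upper:
  "embed_last w v* block_upper P Q R = embed_last (w v* R)"
  by (simp add: vec_sum_eq_iff embed_last_def vector_matrix_mult_def block_upper_def sum_UNIV_Plus)

text \<open>A kernel vector has truncation killed by \<open>P\<close>, hence lies in the last block,
  where the matrix acts as \<open>R\<close>. So the kernel is trivial, and finite dimension gives
  surjectivity.\<close>

lemma bij_block_upper:
  fixes P :: "bit ^ 'n::finite ^ 'n" and R :: "bit ^ 'd::finite ^ 'd"
  assumes P: "invertible P" and R: "invertible R"
  shows "bij (\<lambda>x. x v* block_upper P Q R)"
proof -
  have cancel: "v = 0" if "invertible A" "v v* A = 0" for v :: "bit ^ 'm::finite" and A
  proof -
    from \<open>invertible A\<close> obtain A' where "A ** A' = mat 1"
      unfolding invertible_def by blast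
    then have "v = (v v* A) v* A'"
      by (simp add: vector_matrix_mul_assoc)
    then show ?thesis
      using that by simp
  qed
  have "x = 0" if x: "x v* block_upper P Q R = 0" for x
  proof -
    have "truncate_vec x v* P = 0"
      using truncate_vec_mult_block_upper[of x P Q R] x by simp
    then obtain w where w: "x = embed_last w"
      using cancel[OF P] truncate_vec_eq_0_iff by blast
    then have "w v* R = 0"
      using x by (simp add: embed_last_mult_block_upper)
    then show ?thesis
      using cancel[OF R] w by simp
  qed
  then have "inj (\<lambda>x. x v* block_upper P Q R)"
    by (intro injI) (metis vector_matrix_mult_diff_distrib right_minus_eq)
  with vec.linear_inj_imp_surj[OF linear_vector_matrix_mult] show ?thesis
    by (simp add: bij_def)
qed

text \<open>Block form replaced by a shear: the first block is fixed and only the last coordinates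
  are changed.\<close>

lemma vector_mult_kappa_matrix: "x v* kappa_matrix C = x + embed_last (truncate_vec x v* C)"
proof -
  have "(x v* block_upper P Q R) $ Inr j = (truncate_vec x v* Q) $ j + ((\<chi> j. x $ Inr j) v* R) $ j"
    for P Q R j
    by (simp add: truncate_vec_def vector_matrix_mult_def block_upper_def sum_UNIV_Plus del: add_bit_eq_xor)
  moreover have "(x v* block_upper P Q R) $ Inl i = (truncate_vec x v* P) $ i" for P Q R i
    using truncate_vec_mult_block_upper[of x P Q R] by (simp add: vec_eq_iff truncate_vec_def)
  ultimately show ?thesis
    by (simp add: vec_sum_eq_iff kappa_matrix_def embed_last_def truncate_vec_def add.commute
        del: add_bit_eq_xor)
qed

text \<open>The images of the first n basis vectors show the rows of the matrix. This yields
  uniqueness of the matrices attached to a hidden sum.\<close>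

lemma kappa_matrix_eq_iff:
  fixes C D :: "bit ^ 'd::finite ^ 'n::finite"
  shows "(\<lambda>x. x v* kappa_matrix C) = (\<lambda>x. x v* kappa_matrix D) \<longleftrightarrow> C = D"
proof
  assume "(\<lambda>x. x v* kappa_matrix C) = (\<lambda>x. x v* kappa_matrix D)"
  then have eq: "truncate_vec x v* C = truncate_vec x v* D" for x :: "bit ^ ('n + 'd)"
    by (metis vector_mult_kappa_matrix add_left_imp_eq embed_last_eq_iff)
  then have "C $ i = D $ i" for i
    using eq[of "axis (Inl i) 1"] by (simp add: truncate_vec_axis_Inl axis_vector_matrix_mult)
  then show "C = D"
    by (simp add: vec_eq_iff)
qed simp

section \<open>The operation of a family of matrices\<close>

text \<open>This is the matrix \<open>B_y\<close>, extended linearly from the basis. The scalars act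
  entrywise as in \<open>system_solutions\<close>, so the sum in equation 1 is literally an instance
  of it.\<close>

definition combined_matrix ::
  "('n::finite + 'd::finite \<Rightarrow> bit ^ 'd ^ 'n) \<Rightarrow> bit ^ ('n + 'd) \<Rightarrow> bit ^ 'd ^ 'n" where
  "combined_matrix B y = (\<Sum>j\<in>UNIV. map_matrix ((*) (y $ Inl j)) (B (Inl j)))"

definition family_form ::
  "('n::finite + 'd::finite \<Rightarrow> bit ^ 'd ^ 'n) \<Rightarrow> bit ^ ('n + 'd) \<Rightarrow> bit ^ ('n + 'd) \<Rightarrow> bit ^ 'd" where
  "family_form B x y = truncate_vec x v* combined_matrix B y"

definition family_sum ::
  "('n::finite + 'd::finite \<Rightarrow> bit ^ 'd ^ 'n) \<Rightarrow> bit ^ ('n + 'd) \<Rightarrow> bit ^ ('n + 'd) \<Rightarrow> bit ^ ('n + 'd)" where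
  "family_sum B x y = x + y + embed_last (family_form B x y)"

lemma combined_matrix_add: "combined_matrix B (x + y) = combined_matrix B x + combined_matrix B y"
proof -
  have "map_matrix ((*) (a + b)) C = map_matrix ((*) a) C + map_matrix ((*) b) C"
    for a b :: bit and C :: "bit ^ 'a ^ 'b"
    by (simp only: vec_eq_iff nth_map_matrix vector_add_component distrib_right) simp
  then show ?thesis
    by (simp only: combined_matrix_def vector_add_component sum.distrib)
qed

lemma combined_matrix_embed_last [simp]:
  fixes B :: "'n::finite + 'd::finite \<Rightarrow> bit ^ 'd ^ 'n"
  shows "combined_matrix B (embed_last w) = 0"
proof -
  have "map_matrix ((*) 0) C = 0" for C :: "bit ^ 'd ^ 'n"
    by (simp add: vec_eq_iff)
  then show ?thesis
    by (simp add: combined_matrix_def embed_last_def del: mult_bit_eq_and)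
qed

lemma combined_matrix_axis_Inl [simp]:
  fixes B :: "'n::finite + 'd::finite \<Rightarrow> bit ^ 'd ^ 'n"
  shows "combined_matrix B (axis (Inl i) 1) = B (Inl i)"
proof -
  have "map_matrix ((*) ((axis (Inl i) 1 :: bit ^ ('n + 'd)) $ Inl j)) (B (Inl j)) = (if j = i then B (Inl j) else 0)" for j
    by (simp add: vec_eq_iff axis_def)
  then show ?thesis
    by (simp add: combined_matrix_def del: mult_bit_eq_and)
qed

lemma family_form_add_left: "family_form B (x + y) z = family_form B x z + family_form B y z"
  by (simp add: family_form_def truncate_vec_add vector_matrix_left_distrib)

lemma family_form_add_right: "family_form B x (y + z) = family_form B x y + family_form B x z"
  by (simp add: family_form_def combined_matrix_add vector_matrix_mult_add_rdistrib)

lemma family_form_0_left [simp]: "family_form B 0 x = 0"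
  by (simp add: family_form_def)

lemma family_form_0_right [simp]: "family_form B x 0 = 0"
  using combined_matrix_embed_last[of B 0] by (simp add: family_form_def)

lemma family_form_embed_last_left [simp]: "family_form B (embed_last w) x = 0"
  by (simp add: family_form_def)

lemma family_form_embed_last_right [simp]: "family_form B x (embed_last w) = 0"
  by (simp add: family_form_def)

lemma family_form_axis_Inr [simp]:
  "family_form B (axis (Inr j) 1) x = 0" "family_form B x (axis (Inr j) 1) = 0"
  using family_form_embed_last_left[of B "axis j 1" x] family_form_embed_last_right[of B x "axis j 1"]
  by (simp_all add: embed_last_axis)

lemma family_form_axis_Inl: "family_form B (axis (Inl i) 1) (axis (Inl j) 1) = B (Inl j) $ i"
  by (simp add: family_form_def truncate_vec_axis_Inl axis_vector_matrix_mult)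

section \<open>Alternating families: equations 2 to 4, read on the rows of the matrices\<close>

locale alternating_family =
  fixes B :: "'n::finite + 'd::finite \<Rightarrow> bit ^ 'd ^ 'n"
  assumes last_zero: "\<And>j. B (Inr j) = 0"
    and diagonal: "\<And>i. B (Inl i) $ i = 0"
    and symmetric: "\<And>i j. B (Inl j) $ i = B (Inl i) $ j"
begin

text \<open>By bilinearity it suffices to compare pairs of basis vectors; the form vanishes if one
  of them is among the last d.\<close>

lemma family_form_commute: "family_form B x y = family_form B y x"
proof (induction x rule: bit_vec_induct)
  case (axis k)
  show ?case
  proof (induction y rule: bit_vec_induct)
    case (axis l)
    show ?case
      by (cases k; cases l) (simp_all add: family_form_axis_Inl symmetric)
  qed (simp_all add: family_form_add_left family_form_add_right)
qed (simp_all add: family_form_add_left family_form_add_right)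

lemma family_form_self [simp]: "family_form B x x = 0"
proof (induction x rule: bit_vec_induct)
  case (axis k)
  show ?case
    by (cases k) (simp_all add: family_form_axis_Inl diagonal)
next
  \<comment> \<open>The two cross terms are equal by symmetry and cancel in characteristic
    2.\<close>
  case (add x y)
  then show ?case
    using family_form_commute[of x y] by (simp add: family_form_add_left family_form_add_right)
qed simp

text \<open>The form vanishes on its own values, so both bracketings of a triple sum expand to the
  three vectors plus the three pairwise forms. Exponent 2 is the vanishing of the form on the
  diagonal.\<close>

lemma family_sum_vector_space: "F2_vector_space (family_sum B)"
  unfolding F2_vector_space_iff
proof (intro conjI allI)
  show "family_sum B x y = family_sum B y x" for x y
    using family_form_commute[of x y] by (simp add: family_sum_def add.commute)
qed (simp_all add: family_sum_def family_form_add_left family_form_add_right embed_last_add ac_simps)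

lemma family_sum_axis: "family_sum B x (axis k 1) = x v* kappa_matrix (B k) + axis k 1"
proof (cases k)
  case (Inl i)
  then show ?thesis
    by (simp add: family_sum_def vector_mult_kappa_matrix family_form_def ac_simps)
next
  case (Inr j)
  then show ?thesis
    by (simp add: family_sum_def vector_mult_kappa_matrix last_zero)
qed

text \<open>The generators are the translations by basis vectors. What has to be shown is that the
  basis also generates the space under the new operation.\<close>

lemma translation_group_family_sum:
  "translation_group (family_sum B) = generated_translations B"
proof
  interpret G: group "BijGroup (UNIV :: (bit ^ ('n + 'd)) set)"
    by (rule group_BijGroup)
  interpret T: subgroup "translation_group (family_sum B)" "BijGroup UNIV"
    by (rule subgroup_translation_group[OF family_sum_vector_space])
  have gens: "range (\<lambda>k x. x v* kappa_matrix (B k) + axis k 1) = range (\<lambda>k x. family_sum B x (axis k 1))"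
    by (simp add: family_sum_axis)
  show "generated_translations B \<subseteq> translation_group (family_sum B)"
    unfolding generated_translations_def gens
    by (rule G.generate_subgroup_incl[OF _ T.subgroup_axioms]) (auto simp: translation_group_def)
  have family_sum_assoc: "family_sum B (family_sum B x a) b = family_sum B x (family_sum B a b)" for x a b
    using family_sum_vector_space unfolding F2_vector_space_iff by blast
  have family_sum_0: "family_sum B x 0 = x" for x
    using family_sum_vector_space unfolding F2_vector_space_iff by blast
  \<comment> \<open>\<open>W\<close> collects the vectors reachable from the basis. It is closed
    under \<open>family_sum B\<close>; closure under + is derived first for the last block, then in
    general.\<close>
  define W where "W = {a. (\<lambda>x. family_sum B x a) \<in> generated_translations B}"
  have W_axis: "axis k 1 \<in> W" for k
    by (auto simp: W_def generated_translations_def gens intro!: generate.incl)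
  have W_0: "0 \<in> W"
  proof -
    have "(\<lambda>x. family_sum B x 0) = \<one>\<^bsub>BijGroup UNIV\<^esub>"
      by (auto simp: BijGroup_def family_sum_0 fun_eq_iff)
    then show ?thesis
      using generate.one[of "BijGroup UNIV"] by (simp add: W_def generated_translations_def)
  qed
  have W_sum: "family_sum B a b \<in> W" if "a \<in> W" "b \<in> W" for a b
  proof -
    \<comment> \<open>The product in \<open>BijGroup\<close> applies its right factor first, hence
      the translation by \<open>b\<close> stands on the left.\<close>
    let ?f = "\<lambda>x. family_sum B x b" and ?g = "\<lambda>x. family_sum B x a"
    have "?f \<in> Bij UNIV" "?g \<in> Bij UNIV"
      using bij_translation[OF family_sum_vector_space] by (auto simp: Bij_def)
    then have "?f \<otimes>\<^bsub>BijGroup UNIV\<^esub> ?g = (\<lambda>x. family_sum B x (family_sum B a b))"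
      using family_sum_assoc by (simp add: BijGroup_def compose_def fun_eq_iff)
    then show ?thesis
      using that generate.eng[of ?f "BijGroup UNIV" _ ?g]
      by (simp add: W_def generated_translations_def)
  qed
  \<comment> \<open>On the last block the form is zero, so the new operation is the usual sum
    there.\<close>
  have W_embed: "embed_last w \<in> W" for w
  proof (induction w rule: bit_vec_induct)
    case (add v w)
    then show ?case
      using W_sum[of "embed_last v" "embed_last w"] by (simp add: family_sum_def embed_last_add)
  qed (simp_all add: W_0 W_axis embed_last_axis)
  have "a \<in> W" for a
  proof (induction a rule: bit_vec_induct)
    case (add x y)
    \<comment> \<open>The correction term lies in the last block, so adding it once more with the
      new operation cancels it.\<close>
    have "x + y = family_sum B (family_sum B x y) (embed_last (family_form B x y))"
      by (simp add: family_sum_def add.assoc)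
    then show ?case
      using W_sum W_embed add by metis
  qed (simp_all add: W_0 W_axis)
  then show "translation_group (family_sum B) \<subseteq> generated_translations B"
    by (auto simp: W_def translation_group_def)
qed

lemma kappa_family_sum: "kappa (family_sum B) (axis k 1) = (\<lambda>x. x v* kappa_matrix (B k))"
  by (simp add: kappa_def family_sum_axis add.assoc)

text \<open>The given maps make every generator a translation of \<open>circ\<close>, so one regular
  group contains the other and both operations agree.\<close>

lemma eq_family_sumI:
  fixes circ :: "bit ^ ('n + 'd) \<Rightarrow> bit ^ ('n + 'd) \<Rightarrow> bit ^ ('n + 'd)"
  assumes F: "F2_vector_space circ"
    and kappa: "\<And>k. kappa circ (axis k 1) = (\<lambda>x. x v* kappa_matrix (B k))"
  shows "circ = family_sum B"
proof -
  interpret G: group "BijGroup (UNIV :: (bit ^ ('n + 'd)) set)"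
    by (rule group_BijGroup)
  have "x v* kappa_matrix (B k) + axis k 1 = circ x (axis k 1)" for x k
    using fun_cong[OF kappa[of k], of x, symmetric] by (simp add: kappa_def add.assoc)
  then have "generated_translations B \<subseteq> translation_group circ"
    unfolding generated_translations_def
    by (intro G.generate_subgroup_incl subgroup_translation_group F) (auto simp: translation_group_def)
  then show ?thesis
    using translation_group_subset_imp_eq[OF family_sum_vector_space F] translation_group_family_sum
    by simp
qed

lemma translation_group_family_sum_AGL: "translation_group (family_sum B) \<subseteq> AGL_plus"
proof
  fix t
  assume "t \<in> translation_group (family_sum B)"
  then obtain a where t: "t = (\<lambda>x. family_sum B x a)"
    by (auto simp: translation_group_def)
  let ?f = "\<lambda>x. x v* kappa_matrix (combined_matrix B a)"
  have f: "?f x = x + embed_last (family_form B x a)" for x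
    by (simp add: vector_mult_kappa_matrix family_form_def)
  \<comment> \<open>The shear adds a vector of the last block, which the form ignores; applied twice
    it gives the identity.\<close>
  have "bij ?f"
    by (rule o_bij[where g = ?f]) (simp_all add: f fun_eq_iff family_form_add_left add.assoc)
  then have "?f \<in> GL_plus"
    by (simp add: GL_plus_def linear_vector_matrix_mult)
  moreover have "t = (\<lambda>x. x + a) \<circ> ?f"
    by (simp only: t f) (simp add: fun_eq_iff family_sum_def ac_simps)
  ultimately show "t \<in> AGL_plus"
    unfolding AGL_plus_def translation_group_def by blast
qed

text \<open>Composing the new translation by \<open>a\<close> with the shear of \<open>a\<close>
  cancels the form and leaves the usual translation. The shear respects the new operation because it
  is additive and leaves all values of the form unchanged.\<close>

lemma translation_group_plus_AGL: "translation_group (+) \<subseteq> AGL_circ (family_sum B)"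
proof
  fix t :: "bit ^ ('n + 'd) \<Rightarrow> bit ^ ('n + 'd)"
  assume "t \<in> translation_group (+)"
  then obtain a where t: "t = (\<lambda>x. x + a)"
    by (auto simp: translation_group_def)
  let ?f = "\<lambda>x. x + embed_last (family_form B x a)"
  have "bij ?f"
    by (rule o_bij[where g = ?f]) (simp_all add: fun_eq_iff family_form_add_left add.assoc)
  then have "?f \<in> GL_circ (family_sum B)"
    by (simp add: GL_circ_def family_sum_def family_form_add_left family_form_add_right
        embed_last_add ac_simps)
  moreover have "t = (\<lambda>x. family_sum B x a) \<circ> ?f"
    by (simp add: t fun_eq_iff family_sum_def family_form_add_left ac_simps)
  ultimately show "t \<in> AGL_circ (family_sum B)"
    unfolding AGL_circ_def translation_group_def by blast
qed

lemma embed_last_in_U_set: "embed_last w \<in> U_set (translation_group (family_sum B))"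
  by (auto simp: U_set_def translation_group_def family_sum_def intro!: exI[of _ "embed_last w"])

text \<open>The rows of the matrices are values of the form on basis vectors. This singles out the
  one solution whose operation is not a hidden sum.\<close>

lemma family_sum_eq_plus_iff: "family_sum B = (+) \<longleftrightarrow> B = (\<lambda>k. 0)"
proof
  assume "family_sum B = (+)"
  then have "family_form B x y = 0" for x y
    by (simp add: family_sum_def fun_eq_iff add.assoc)
  then have "B (Inl j) $ i = 0" for i j
    by (metis family_form_axis_Inl)
  then show "B = (\<lambda>k. 0)"
    by (simp add: fun_eq_iff vec_eq_iff split_sum_all last_zero)
next
  assume B: "B = (\<lambda>k. 0)"
  have "map_matrix ((*) c) 0 = (0 :: bit ^ 'd ^ 'n)" for c
    by (simp add: vec_eq_iff)
  then show "family_sum B = (+)"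
    by (simp add: B fun_eq_iff family_sum_def family_form_def combined_matrix_def)
qed

text \<open>The map is already linear for +, so preserving the new operation means carrying the form
  to itself up to \<open>L3\<close>. Removing the first argument turns this into a matrix identity
  in y, additive in y and hence decided on the basis.\<close>

lemma block_upper_in_GL_circ_iff:
  assumes "invertible L1" and "invertible L3"
  shows "(\<lambda>x. x v* block_upper L1 M L3) \<in> GL_circ (family_sum B) \<longleftrightarrow>
    (\<forall>i. B (Inl i) ** L3 = L1 ** combined_matrix B (axis (Inl i) 1 v* block_upper L1 M L3))"
    (is "?GL \<longleftrightarrow> ?eq")
proof -
  let ?l = "\<lambda>x. x v* block_upper L1 M L3"
  have form_l: "family_form B (?l x) (?l y) = truncate_vec x v* (L1 ** combined_matrix B (?l y))" for x y
    by (simp add: family_form_def truncate_vec_mult_block_upper vector_matrix_mul_assoc)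
  have l_form: "family_form B x y v* L3 = truncate_vec x v* (combined_matrix B y ** L3)" for x y
    by (simp add: family_form_def vector_matrix_mul_assoc)
  have "?GL \<longleftrightarrow> (\<forall>x y. family_form B x y v* L3 = family_form B (?l x) (?l y))"
    using bij_block_upper[OF assms]
    by (simp add: GL_circ_def family_sum_def vector_matrix_left_distrib embed_last_mult_block_upper)
  also have "\<dots> \<longleftrightarrow> (\<forall>y. combined_matrix B y ** L3 = L1 ** combined_matrix B (?l y))"
  proof
    assume *: "\<forall>x y. family_form B x y v* L3 = family_form B (?l x) (?l y)"
    \<comment> \<open>Taking x to be a basis vector of the first block extracts row i of both
      matrices.\<close>
    have "axis i 1 v* (combined_matrix B y ** L3) = axis i 1 v* (L1 ** combined_matrix B (?l y))" for y i
      using *[rule_format, of "axis (Inl i) 1" y] by (simp only: form_l l_form truncate_vec_axis_Inl)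
    then have "(combined_matrix B y ** L3) $ i = (L1 ** combined_matrix B (?l y)) $ i" for y i
      unfolding axis_vector_matrix_mult .
    then show "\<forall>y. combined_matrix B y ** L3 = L1 ** combined_matrix B (?l y)"
      by (simp only: vec_eq_iff) simp
  qed (simp only: form_l l_form, simp)
  also have "\<dots> \<longleftrightarrow> ?eq"
  proof
    assume eq: ?eq
    show "\<forall>y. combined_matrix B y ** L3 = L1 ** combined_matrix B (?l y)"
    proof
      fix y
      show "combined_matrix B y ** L3 = L1 ** combined_matrix B (?l y)"
      proof (induction y rule: bit_vec_induct)
        case zero
        then show ?case
          using combined_matrix_embed_last[of B 0] by simp
      next
        case (axis k)
        then show ?case
          \<comment> \<open>For the last d basis vectors both sides vanish, since the block shape
            keeps the last block invariant.\<close>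
          using eq by (cases k) (simp_all add: embed_last_mult_block_upper flip: embed_last_axis)
      next
        case (add x y)
        then show ?case
          by (simp add: combined_matrix_add vector_matrix_left_distrib matrix_mult_add_rdistrib matrix_add_ldistrib)
      qed
    qed
  qed (metis combined_matrix_axis_Inl)
  finally show ?thesis .
qed

end

section \<open>The linear system and the matrices of a given operation\<close>

lemma system_solutions_iff:
  "B \<in> system_solutions lam L1 L3 \<longleftrightarrow> alternating_family B \<and>
    (\<forall>i. B (Inl i) ** L3 = L1 ** combined_matrix B (axis (Inl i) 1 v* lam))"
  by (auto simp: system_solutions_def alternating_family_def combined_matrix_def
      truncate_vec_axis_Inl axis_vector_matrix_mult)

text \<open>On the first n basis vectors, \<open>circ\<close> differs from + by a row of some
  \<open>B (Inl j)\<close>. Exponent 2 then kills the diagonal rows, and commutativity makes the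
  remaining ones symmetric.\<close>

lemma alternating_family_of_kappa:
  fixes B :: "'n::finite + 'd::finite \<Rightarrow> bit ^ 'd ^ 'n"
  assumes F: "F2_vector_space circ"
    and last: "\<And>j::'d. B (Inr j) = 0"
    and kappa: "\<And>k. kappa circ (axis k 1) = (\<lambda>x. x v* kappa_matrix (B k))"
  shows "alternating_family B"
proof
  note laws = F[unfolded F2_vector_space_iff]
  have circ: "circ x (axis k 1) = x + embed_last (truncate_vec x v* B k) + axis k 1" for x k
  proof -
    have "circ x (axis k 1) = kappa circ (axis k 1) x + axis k 1"
      by (simp add: kappa_def add.assoc)
    then show ?thesis
      by (simp add: kappa vector_mult_kappa_matrix)
  qed
  then have circ_axis: "circ (axis (Inl i) 1) (axis (Inl j) 1) =
      axis (Inl i) 1 + axis (Inl j) 1 + embed_last (B (Inl j) $ i)" for i j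
    by (simp add: truncate_vec_axis_Inl axis_vector_matrix_mult ac_simps)
  show "B (Inl i) $ i = 0" for i
    using circ_axis[of i i] laws by simp
  show "B (Inl j) $ i = B (Inl i) $ j" for i j
  proof -
    have "circ (axis (Inl i) 1) (axis (Inl j) 1) = circ (axis (Inl j) 1) (axis (Inl i) 1)"
      using laws by blast
    then show ?thesis
      by (simp add: circ_axis add.commute[of "axis (Inl j) 1"])
  qed
qed (rule last)

text \<open>The usual translation by \<open>v\<close> is a translation of \<open>circ\<close>, and
  evaluation at 0 shows that its parameter is again \<open>v\<close>. This is the source of equation
  2.\<close>

lemma kappa_of_U_set:
  assumes F: "F2_vector_space circ" and v: "v \<in> U_set (translation_group circ)"
  shows "kappa circ v = (\<lambda>x. x)"
proof -
  note laws = F[unfolded F2_vector_space_iff]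
  obtain a where a: "\<And>x. x + v = circ x a"
    using v unfolding U_set_def translation_group_def by (auto simp: fun_eq_iff)
  have "circ 0 a = a"
    using laws by metis
  then have "a = v"
    using a[of 0] by simp
  then have "circ x v = x + v" for x
    using a by simp
  then show ?thesis
    by (simp add: kappa_def add.assoc)
qed

theorem mainTheorem5:
  fixes L1 :: "bit ^ 'n::finite ^ 'n" and L3 :: "bit ^ 'd::finite ^ 'd" and M :: "bit ^ 'd ^ 'n"
    and lam :: "bit ^ ('n + 'd) ^ ('n + 'd)"
  assumes "CARD('n) \<ge> 2" and "CARD('d) \<ge> 1"
    and "invertible L1" and "invertible L3"
    and "lam = block_upper L1 M L3"
  shows
    "(\<forall>B \<in> system_solutions lam L1 L3. \<exists>!circ.
        F2_vector_space circ \<and>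
        translation_group circ = generated_translations B \<and>
        (\<forall>k. kappa circ (axis k 1) = (\<lambda>x. x v* kappa_matrix (B k))) \<and>
        translation_group circ \<subseteq> AGL_plus \<and>
        translation_group (+) \<subseteq> AGL_circ circ \<and>
        (\<forall>j::'d. axis (Inr j) 1 \<in> U_set (translation_group circ)) \<and>
        (\<lambda>x. x v* lam) \<in> GL_circ circ \<and>
        (if B = (\<lambda>k. 0) then circ = (+) else practical_hidden_sum circ))
     \<and>
     (\<forall>circ.
        practical_hidden_sum circ \<and>
        (\<forall>i::'n. \<exists>C. kappa circ (axis (Inl i) 1) = (\<lambda>x. x v* kappa_matrix C)) \<and>
        (\<forall>j::'d. axis (Inr j) 1 \<in> U_set (translation_group circ)) \<and>
        (\<lambda>x. x v* lam) \<in> GL_circ circ \<longrightarrow>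
        (\<exists>!B. \<forall>k. kappa circ (axis k 1) = (\<lambda>x. x v* kappa_matrix (B k))) \<and>
        (\<forall>B. (\<forall>k. kappa circ (axis k 1) = (\<lambda>x. x v* kappa_matrix (B k))) \<longrightarrow>
             B \<in> system_solutions lam L1 L3 \<and>
             translation_group circ = generated_translations B))"
proof (intro conjI ballI allI impI)
  fix B
  assume B: "B \<in> system_solutions lam L1 L3"
  then interpret alternating_family B
    by (simp add: system_solutions_iff)
  have lam: "(\<lambda>x. x v* lam) \<in> GL_circ (family_sum B)"
    using B block_upper_in_GL_circ_iff[OF assms(3,4)] by (simp add: system_solutions_iff assms(5))
  \<comment> \<open>The zero family solves the homogeneous system but returns the usual sum, which
    is by definition not a hidden sum; hence the case distinction.\<close>
  have hidden: "if B = (\<lambda>k. 0) then family_sum B = (+) else practical_hidden_sum (family_sum B)"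
    unfolding practical_hidden_sum_def hidden_sum_def family_sum_eq_plus_iff
    using family_sum_vector_space translation_group_plus_AGL translation_group_family_sum_AGL
    by (simp only: simp_thms split: if_split)
  have last: "axis (Inr j) 1 \<in> U_set (translation_group (family_sum B))" for j
    using embed_last_in_U_set[of "axis j 1"] by (simp add: embed_last_axis)
  show "\<exists>!circ.
        F2_vector_space circ \<and>
        translation_group circ = generated_translations B \<and>
        (\<forall>k. kappa circ (axis k 1) = (\<lambda>x. x v* kappa_matrix (B k))) \<and>
        translation_group circ \<subseteq> AGL_plus \<and>
        translation_group (+) \<subseteq> AGL_circ circ \<and>
        (\<forall>j::'d. axis (Inr j) 1 \<in> U_set (translation_group circ)) \<and>
        (\<lambda>x. x v* lam) \<in> GL_circ circ \<and>
        (if B = (\<lambda>k. 0) then circ = (+) else practical_hidden_sum circ)"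
    (is "\<exists>!circ. ?P circ")
  proof (rule ex1I[of _ "family_sum B"])
    show "?P (family_sum B)"
      by (intro conjI allI)
        (fact family_sum_vector_space translation_group_family_sum kappa_family_sum last lam hidden
           translation_group_family_sum_AGL translation_group_plus_AGL)+
    show "circ = family_sum B" if "?P circ" for circ
      by (rule eq_family_sumI) (use that in simp_all)
  qed
next
  fix circ :: "bit ^ ('n + 'd) \<Rightarrow> bit ^ ('n + 'd) \<Rightarrow> bit ^ ('n + 'd)"
  assume H: "practical_hidden_sum circ \<and>
        (\<forall>i::'n. \<exists>C. kappa circ (axis (Inl i) 1) = (\<lambda>x. x v* kappa_matrix C)) \<and>
        (\<forall>j::'d. axis (Inr j) 1 \<in> U_set (translation_group circ)) \<and>
        (\<lambda>x. x v* lam) \<in> GL_circ circ"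
  then have F: "F2_vector_space circ"
    by (simp add: practical_hidden_sum_def hidden_sum_def)
  \<comment> \<open>The condition on U makes these maps the identity, which is the shear of the zero
    matrix.\<close>
  have kappa_last:
    "kappa circ (axis (Inr j) 1) = (\<lambda>x. x v* kappa_matrix (0 :: bit ^ 'd ^ 'n))" for j
    using kappa_of_U_set[OF F] H by (simp add: vector_mult_kappa_matrix)
  obtain C where C: "\<And>i. kappa circ (axis (Inl i) 1) = (\<lambda>x. x v* kappa_matrix (C i))"
    using H by metis
  show "\<exists>!B. \<forall>k. kappa circ (axis k 1) = (\<lambda>x. x v* kappa_matrix (B k))"
  \<comment> \<open>The witness joins the matrices given for the first block with the zeros forced
    on the last one.\<close>
  proof (rule ex1I[of _ "case_sum C (\<lambda>j. 0)"])
    show *: "\<forall>k. kappa circ (axis k 1) = (\<lambda>x. x v* kappa_matrix (case_sum C (\<lambda>j. 0) k))"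
      using C kappa_last by (simp add: split_sum_all)
    show "B = case_sum C (\<lambda>j. 0)"
      if "\<forall>k. kappa circ (axis k 1) = (\<lambda>x. x v* kappa_matrix (B k))" for B
    proof
      fix k
      have "(\<lambda>x. x v* kappa_matrix (B k)) = (\<lambda>x. x v* kappa_matrix (case_sum C (\<lambda>j. 0) k))"
        using that * by simp
      then show "B k = case_sum C (\<lambda>j. 0) k"
        by (simp only: kappa_matrix_eq_iff)
    qed
  qed
  fix B
  assume kappa: "\<forall>k. kappa circ (axis k 1) = (\<lambda>x. x v* kappa_matrix (B k))"
  have "B (Inr j) = 0" for j
    using kappa kappa_last[of j] by (simp add: kappa_matrix_eq_iff)
  then interpret alternating_family B
    using alternating_family_of_kappa[OF F] kappa by blast
  \<comment> \<open>Once the operation is identified, equation 1 is the isometry criterion for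
    \<open>lam\<close>, and the generated group is its translation group.\<close>
  have circ: "circ = family_sum B"
    using eq_family_sumI[OF F] kappa by blast
  show "B \<in> system_solutions lam L1 L3"
    using H block_upper_in_GL_circ_iff[OF assms(3,4)] alternating_family_axioms
    by (simp add: system_solutions_iff circ assms(5))
  show "translation_group circ = generated_translations B"
    by (simp add: circ translation_group_family_sum)
qed

end
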